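(* For every term $M$ of $\lambda^{Sym}_{Prop}$, $(M^{\mathfrak f})^{\mathfrak e}\to^* M$.
   Context: $\lambda^{Sym}_{Prop}$ terms are built from variables by $\langle P_1,P_2\rangle$, $\sigma_i(P)$ ($i=1,2$), $\lambda xP$, $(P_1\star P_2)$ (typed with m-types/$\bot$ as usual: $\langle P_1,P_2\rangle:A_1\wedge A_2$, $\sigma_i(P_i):A_1\vee A_2$, $\lambda xP:A^\bot$ from $x:A\vdash P:\bot$, $(P_1\star P_2):\bot$ from $P_1:A^\bot,P_2:A$). $\to^*$ is the reflexive transitive closure of the compatible closure of: $(\lambda xP\star Q)\to P[x:=Q]$; $(Q\star\lambda xP)\to P[x:=Q]$; $\lambda x(P\star x)\to P$ and $\lambda x(x\star P)\to P$ if $x\notin Fv(P)$; $(\langle P_1,P_2\rangle\star\sigma_i(Q))\to(P_i\star Q)$; $(\sigma_i(Q)\star\langle P_1,P_2\rangle)\to(Q\star P_i)$; $E[P]\to P$ for one-hole contexts $E[-]\neq[-]$ of type $\bot$ with $P:\bot$ and no free variable of $P$ bound by $E$. $\overline{\lambda}\mu\tilde{\mu}^*$ terms: $p::=\lfloor t,e\rfloor$; $t::=x\mid\lambda x\,t\mid\mu\alpha\,p\mid\overline{e}$; $e::=\alpha\mid(t.e)\mid\tilde{\mu}x\,p\mid\widetilde{t}$ ($x$ $l$-variables, which are the variables of $\lambda^{Sym}_{Prop}$; $\alpha$ $r$-variables). Translation $\cdot^{\mathfrak f}$ from $\lambda^{Sym}_{Prop}$ to $\overline{\lambda}\mu\tilde{\mu}^*$: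 $x^{\mathfrak f}=x$; $(P\star Q)^{\mathfrak f}=\lfloor Q^{\mathfrak f},\widetilde{P^{\mathfrak f}}\rfloor$; $(\lambda xN)^{\mathfrak f}=\overline{\tilde\mu x\,N^{\mathfrak f}}$; $\langle P,Q\rangle^{\mathfrak f}=\overline{(P^{\mathfrak f}.\widetilde{Q^{\mathfrak f}})}$; $\sigma_1(N)^{\mathfrak f}=\lambda x\,\mu\beta\lfloor N^{\mathfrak f},\widetilde{x}\rfloor$ ($x,\beta$ fresh); $\sigma_2(N)^{\mathfrak f}=\lambda x\,N^{\mathfrak f}$ ($x$ fresh). Translation $\cdot^{\mathfrak e}$ from $\overline{\lambda}\mu\tilde{\mu}^*$ to $\lambda^{Sym}_{Prop}$: each $r$-variable $\alpha$ has an associated fresh variable $\overline{\alpha}$; $\pi_i(y)=\lambda z(y\star\sigma_i(z))$; $\lfloor v,u\rfloor^{\mathfrak e}=(u^{\mathfrak e}\star v^{\mathfrak e})$; $x^{\mathfrak e}=x$; $(\lambda x\,u)^{\mathfrak e}=\lambda y(\lambda x(\pi_2(y)\star u^{\mathfrak e})\star\pi_1(y))$ ($y,z$ fresh); $(\mu\alpha\,p)^{\mathfrak e}=\lambda\overline{\alpha}\,p^{\mathfrak e}$; $(\overline{h})^{\mathfrak e}=h^{\mathfrak e}$; $\alpha^{\mathfrak e}=\overline{\alpha}$; $(t.h)^{\mathfrak e}=\langle t^{\mathfrak e},h^{\mathfrak e}\rangle$; $(\tilde\mu x\,p)^{\mathfrak e}=\lambda x\,p^{\mathfrak e}$; $(\widetilde{u})^{\mathfrak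 e}=u^{\mathfrak e}$. *)

theory Defs
  imports Main
begin

section \<open>The calculus lambda-Sym-Prop\<close>

text \<open>
  Terms of both calculi are taken up to renaming of bound variables and are therefore written with
  de Bruijn indices. An index pointing beyond all binders is a free variable, namely an entry of
  the typing context.
\<close>

datatype mtype = Atom nat | NegAtom nat | And mtype mtype | Or mtype mtype

primrec dual :: "mtype \<Rightarrow> mtype" where
  "dual (Atom a) = NegAtom a"
| "dual (NegAtom a) = Atom a"
| "dual (And A B) = Or (dual A) (dual B)"
| "dual (Or A B) = And (dual A) (dual B)"

datatype ty = MT mtype | Bot

datatype idx = I1 | I2

primrec pick :: "idx \<Rightarrow> 'a \<Rightarrow> 'a \<Rightarrow> 'a" where
  "pick I1 a b = a"
| "pick I2 a b = b"

datatype trm =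
    Var nat
  | Pairing trm trm
  | Inj idx trm
  | Lam trm
  | Star trm trm  (infixl "\<star>" 70)

inductive typing :: "mtype list \<Rightarrow> trm \<Rightarrow> ty \<Rightarrow> bool"  ("_ \<turnstile> _ : _" [51, 51, 51] 50) where
  ty_var:   "i < length \<Gamma> \<Longrightarrow> \<Gamma> \<turnstile> Var i : MT (\<Gamma> ! i)"
| ty_pair:  "\<Gamma> \<turnstile> P1 : MT A1 \<Longrightarrow> \<Gamma> \<turnstile> P2 : MT A2 \<Longrightarrow> \<Gamma> \<turnstile> Pairing P1 P2 : MT (And A1 A2)"
| ty_inj:   "\<Gamma> \<turnstile> P : MT (pick i A1 A2) \<Longrightarrow> \<Gamma> \<turnstile> Inj i P : MT (Or A1 A2)"
| ty_lam:   "A # \<Gamma> \<turnstile> P : Bot \<Longrightarrow> \<Gamma> \<turnstile> Lam P : MT (dual A)"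
| ty_star:  "\<Gamma> \<turnstile> P1 : MT (dual A) \<Longrightarrow> \<Gamma> \<turnstile> P2 : MT A \<Longrightarrow> \<Gamma> \<turnstile> P1 \<star> P2 : Bot"

primrec lift :: "nat \<Rightarrow> trm \<Rightarrow> trm" where
  "lift k (Var i) = Var (if i < k then i else Suc i)"
| "lift k (Pairing P Q) = Pairing (lift k P) (lift k Q)"
| "lift k (Inj i P) = Inj i (lift k P)"
| "lift k (Lam P) = Lam (lift (Suc k) P)"
| "lift k (P \<star> Q) = lift k P \<star> lift k Q"

primrec subst :: "trm \<Rightarrow> nat \<Rightarrow> trm \<Rightarrow> trm" where
  "subst (Var i) k R = (if i < k then Var i else if i = k then R else Var (i - 1))"
| "subst (Pairing P Q) k R = Pairing (subst P k R) (subst Q k R)"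
| "subst (Inj i P) k R = Inj i (subst P k R)"
| "subst (Lam P) k R = Lam (subst P (Suc k) (lift 0 R))"
| "subst (P \<star> Q) k R = subst P k R \<star> subst Q k R"

datatype ctx =
    Hole
  | CPairingL ctx trm
  | CPairingR trm ctx
  | CInj idx ctx
  | CLam ctx
  | CStarL ctx trm
  | CStarR trm ctx

text \<open>
  \<open>fill E P\<close> lifts \<open>P\<close> when it passes a binder of \<open>E\<close>, so it is \<open>E[P]\<close> under the proviso that
  \<open>E\<close> binds no free variable of \<open>P\<close>.
\<close>

primrec fill :: "ctx \<Rightarrow> trm \<Rightarrow> trm" where
  "fill Hole P = P"
| "fill (CPairingL E Q) P = Pairing (fill E P) Q"
| "fill (CPairingR Q E) P = Pairing Q (fill E P)"
| "fill (CInj i E) P = Inj i (fill E P)"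
| "fill (CLam E) P = Lam (fill E (lift 0 P))"
| "fill (CStarL E Q) P = fill E P \<star> Q"
| "fill (CStarR Q E) P = Q \<star> fill E P"

text \<open>
  In the eta rules, \<open>lift 0 P\<close> expresses that the bound variable is not free in \<open>P\<close>. In \<open>triv\<close>,
  some typing of \<open>fill E P\<close> is required; whether the type is \<open>Bot\<close> does not depend on its choice, as
  the terms of type \<open>Bot\<close> are exactly the typable terms \<open>P \<star> Q\<close>.
\<close>

inductive red :: "trm \<Rightarrow> trm \<Rightarrow> bool"  (infix "\<rightarrow>\<^sub>S" 50) where
  beta:      "Lam P \<star> Q \<rightarrow>\<^sub>S subst P 0 Q"
| beta_perp: "Q \<star> Lam P \<rightarrow>\<^sub>S subst P 0 Q"
| eta:       "Lam (lift 0 P \<star> Var 0) \<rightarrow>\<^sub>S P"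
| eta_perp:  "Lam (Var 0 \<star> lift 0 P) \<rightarrow>\<^sub>S P"
| proj:      "Pairing P1 P2 \<star> Inj i Q \<rightarrow>\<^sub>S pick i P1 P2 \<star> Q"
| proj_perp: "Inj i Q \<star> Pairing P1 P2 \<rightarrow>\<^sub>S Q \<star> pick i P1 P2"
| triv:      "E \<noteq> Hole \<Longrightarrow> \<Gamma> \<turnstile> fill E P : Bot \<Longrightarrow> \<Gamma> \<turnstile> P : Bot \<Longrightarrow> fill E P \<rightarrow>\<^sub>S P"
| pairL:     "P \<rightarrow>\<^sub>S P' \<Longrightarrow> Pairing P Q \<rightarrow>\<^sub>S Pairing P' Q"
| pairR:     "Q \<rightarrow>\<^sub>S Q' \<Longrightarrow> Pairing P Q \<rightarrow>\<^sub>S Pairing P Q'"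
| inj:       "P \<rightarrow>\<^sub>S P' \<Longrightarrow> Inj i P \<rightarrow>\<^sub>S Inj i P'"
| lam:       "P \<rightarrow>\<^sub>S P' \<Longrightarrow> Lam P \<rightarrow>\<^sub>S Lam P'"
| starL:     "P \<rightarrow>\<^sub>S P' \<Longrightarrow> P \<star> Q \<rightarrow>\<^sub>S P' \<star> Q"
| starR:     "Q \<rightarrow>\<^sub>S Q' \<Longrightarrow> P \<star> Q \<rightarrow>\<^sub>S P \<star> Q'"

abbreviation reds :: "trm \<Rightarrow> trm \<Rightarrow> bool"  (infix "\<rightarrow>\<^sub>S\<^sup>*" 50) where
  "P \<rightarrow>\<^sub>S\<^sup>* Q \<equiv> red\<^sup>*\<^sup>* P Q"


section \<open>The calculus lambda-bar-mu-mu-tilde-star\<close>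

text \<open>
  The three binders share one index space: \<open>LVar i\<close> and \<open>RVar i\<close> both refer to the \<open>i\<close>-th
  enclosing binder (or context entry), which has to be one for l-variables (\<open>LLam\<close>, \<open>MuT\<close>),
  respectively for r-variables (\<open>Mu\<close>). This side condition is the predicate \<open>scoped\<close> below.
\<close>

datatype cmd = Cut ltm rtm
  and ltm = LVar nat | LLam ltm | Mu cmd | Over rtm
  and rtm = RVar nat | Stack ltm rtm | MuT cmd | Tilde ltm

datatype lmm = Cmd cmd | LTm ltm | RTm rtm

datatype vsort = SL | SR

primrec scoped_cmd :: "(nat \<Rightarrow> vsort) \<Rightarrow> cmd \<Rightarrow> bool"
  and scoped_ltm :: "(nat \<Rightarrow> vsort) \<Rightarrow> ltm \<Rightarrow> bool"
  and scoped_rtm :: "(nat \<Rightarrow> vsort) \<Rightarrow> rtm \<Rightarrow> bool"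
where
  "scoped_cmd S (Cut t e) \<longleftrightarrow> scoped_ltm S t \<and> scoped_rtm S e"
| "scoped_ltm S (LVar i) \<longleftrightarrow> S i = SL"
| "scoped_ltm S (LLam t) \<longleftrightarrow> scoped_ltm (case_nat SL S) t"
| "scoped_ltm S (Mu p) \<longleftrightarrow> scoped_cmd (case_nat SR S) p"
| "scoped_ltm S (Over e) \<longleftrightarrow> scoped_rtm S e"
| "scoped_rtm S (RVar i) \<longleftrightarrow> S i = SR"
| "scoped_rtm S (Stack t e) \<longleftrightarrow> scoped_ltm S t \<and> scoped_rtm S e"
| "scoped_rtm S (MuT p) \<longleftrightarrow> scoped_cmd (case_nat SL S) p"
| "scoped_rtm S (Tilde t) \<longleftrightarrow> scoped_ltm S t"

primrec scoped :: "(nat \<Rightarrow> vsort) \<Rightarrow> lmm \<Rightarrow> bool" where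
  "scoped S (Cmd p) = scoped_cmd S p"
| "scoped S (LTm t) = scoped_ltm S t"
| "scoped S (RTm e) = scoped_rtm S e"

primrec lift_cmd :: "nat \<Rightarrow> cmd \<Rightarrow> cmd"
  and lift_ltm :: "nat \<Rightarrow> ltm \<Rightarrow> ltm"
  and lift_rtm :: "nat \<Rightarrow> rtm \<Rightarrow> rtm"
where
  "lift_cmd k (Cut t e) = Cut (lift_ltm k t) (lift_rtm k e)"
| "lift_ltm k (LVar i) = LVar (if i < k then i else Suc i)"
| "lift_ltm k (LLam t) = LLam (lift_ltm (Suc k) t)"
| "lift_ltm k (Mu p) = Mu (lift_cmd (Suc k) p)"
| "lift_ltm k (Over e) = Over (lift_rtm k e)"
| "lift_rtm k (RVar i) = RVar (if i < k then i else Suc i)"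
| "lift_rtm k (Stack t e) = Stack (lift_ltm k t) (lift_rtm k e)"
| "lift_rtm k (MuT p) = MuT (lift_cmd (Suc k) p)"
| "lift_rtm k (Tilde t) = Tilde (lift_ltm k t)"


section \<open>The translation f\<close>

text \<open>
  Variables have m-types, so the terms of type \<open>Bot\<close> are the typable terms \<open>P \<star> Q\<close>; these are
  translated to commands, all others to l-terms. The \<open>undefined\<close> cases only arise for terms that
  are not typable.
\<close>

fun tr_f_cmd :: "trm \<Rightarrow> cmd" and tr_f_ltm :: "trm \<Rightarrow> ltm" where
  "tr_f_cmd (P \<star> Q) = Cut (tr_f_ltm Q) (Tilde (tr_f_ltm P))"
| "tr_f_cmd _ = undefined"
| "tr_f_ltm (Var i) = LVar i"
| "tr_f_ltm (Lam N) = Over (MuT (tr_f_cmd N))"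
| "tr_f_ltm (Pairing P Q) = Over (Stack (tr_f_ltm P) (Tilde (tr_f_ltm Q)))"
| "tr_f_ltm (Inj I1 N) = LLam (Mu (Cut (lift_ltm 0 (lift_ltm 0 (tr_f_ltm N))) (Tilde (LVar 1))))"
| "tr_f_ltm (Inj I2 N) = LLam (lift_ltm 0 (tr_f_ltm N))"
| "tr_f_ltm (P \<star> Q) = undefined"

fun tr_f :: "trm \<Rightarrow> lmm" where
  "tr_f (P \<star> Q) = Cmd (tr_f_cmd (P \<star> Q))"
| "tr_f P = LTm (tr_f_ltm P)"

text \<open>On typable terms, the result is a well-scoped term without free r-variables.\<close>

lemma scoped_lift:
  "(\<And>i. S' (if i < k then i else Suc i) = S i) \<Longrightarrow> scoped_cmd S' (lift_cmd k p) = scoped_cmd S p"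
  "(\<And>i. S' (if i < k then i else Suc i) = S i) \<Longrightarrow> scoped_ltm S' (lift_ltm k t) = scoped_ltm S t"
  "(\<And>i. S' (if i < k then i else Suc i) = S i) \<Longrightarrow> scoped_rtm S' (lift_rtm k u) = scoped_rtm S u"
proof (induction p and t and u arbitrary: k S S' and k S S' and k S S')
  case (LLam t)
  show ?case apply simp apply (rule LLam.IH) subgoal for i using LLam.prems[of "i-1"] by (cases i) auto done
next
  case (Mu p)
  show ?case apply simp apply (rule Mu.IH) subgoal for i using Mu.prems[of "i-1"] by (cases i) auto done
next
  case (MuT p)
  show ?case apply simp apply (rule MuT.IH) subgoal for i using MuT.prems[of "i-1"] by (cases i) auto done
qed (simp_all, (metis+)?)

lemma scoped_f_aux:
  "\<Gamma> \<turnstile> P : T \<Longrightarrow> (case T of Bot \<Rightarrow> (\<exists>Q R. P = Q \<star> R) \<and> scoped_cmd (\<lambda>_. SL) (tr_f_cmd P)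
     | MT A \<Rightarrow> (\<forall>Q R. P \<noteq> Q \<star> R) \<and> scoped_ltm (\<lambda>_. SL) (tr_f_ltm P))"
proof (induction rule: typing.induct)
  case (ty_inj \<Gamma> P i A1 A2)
  then show ?case
    by (cases i) (auto simp: scoped_lift(2)[where S="\<lambda>_. SL"] scoped_lift(2)[where S="case_nat SL (\<lambda>_. SL)"])
next
  case (ty_lam A \<Gamma> P)
  have "case_nat SL (\<lambda>_. SL) = (\<lambda>_. SL)" by (auto split: nat.split)
  with ty_lam show ?case by auto
qed auto

lemma scoped_tr_f: "\<Gamma> \<turnstile> P : T \<Longrightarrow> scoped (\<lambda>_. SL) (tr_f P)"
  using scoped_f_aux[of \<Gamma> P T] by (cases T; cases P) auto


section \<open>The translation e\<close>

definition prj :: "idx \<Rightarrow> nat \<Rightarrow> trm" where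
  "prj i y = Lam (Var (Suc y) \<star> Inj i (Var 0))"

text \<open>
  Since l- and r-variables already have distinct indices, the variable associated with the
  r-variable \<open>RVar i\<close> is \<open>Var i\<close>. In the clause for \<open>LLam\<close>, the new binder \<open>y\<close> is inserted outside
  of the binder \<open>x\<close>, whence the lifting from 1.
\<close>

primrec tr_e_cmd :: "cmd \<Rightarrow> trm" and tr_e_ltm :: "ltm \<Rightarrow> trm" and tr_e_rtm :: "rtm \<Rightarrow> trm" where
  "tr_e_cmd (Cut v u) = tr_e_rtm u \<star> tr_e_ltm v"
| "tr_e_ltm (LVar i) = Var i"
| "tr_e_ltm (LLam u) = Lam (Lam (prj I2 1 \<star> lift 1 (tr_e_ltm u)) \<star> prj I1 0)"
| "tr_e_ltm (Mu p) = Lam (tr_e_cmd p)"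
| "tr_e_ltm (Over h) = tr_e_rtm h"
| "tr_e_rtm (RVar i) = Var i"
| "tr_e_rtm (Stack t h) = Pairing (tr_e_ltm t) (tr_e_rtm h)"
| "tr_e_rtm (MuT p) = Lam (tr_e_cmd p)"
| "tr_e_rtm (Tilde u) = tr_e_ltm u"

primrec tr_e :: "lmm \<Rightarrow> trm" where
  "tr_e (Cmd p) = tr_e_cmd p"
| "tr_e (LTm t) = tr_e_ltm t"
| "tr_e (RTm h) = tr_e_rtm h"

end

theory Submission
  imports Defs
begin

text \<open>
  Except for injections, the composed translation is the identity up to the subterms. On
  injections, with \<open>N'\<close> the image of \<open>N\<close>, the projections are consumed by the symmetric beta
  rule and what remains is an eta-perp redex:
  \<open>\<lambda>y (\<lambda>x (\<pi>\<^sub>2(y) \<star> \<lambda>\<beta> (x \<star> N')) \<star> \<pi>\<^sub>1(y)) \<rightarrow> \<lambda>y (\<lambda>x (x \<star> N') \<star> \<pi>\<^sub>1(y)) \<rightarrow> \<lambda>y (N' \<star> \<pi>\<^sub>1(y)) \<rightarrow>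
  \<lambda>y (y \<star> \<sigma>\<^sub>1(N')) \<rightarrow> \<sigma>\<^sub>1(N')\<close>, and
  \<open>\<lambda>y (\<lambda>x (\<pi>\<^sub>2(y) \<star> N') \<star> \<pi>\<^sub>1(y)) \<rightarrow> \<lambda>y (\<pi>\<^sub>2(y) \<star> N') \<rightarrow> \<lambda>y (y \<star> \<sigma>\<^sub>2(N')) \<rightarrow> \<sigma>\<^sub>2(N')\<close>.
\<close>

lemma lift_lift: "i \<le> k \<Longrightarrow> lift i (lift k P) = lift (Suc k) (lift i P)"
  by (induction P arbitrary: i k) auto

lemma subst_lift [simp]: "subst (lift k P) k R = P"
  by (induction P arbitrary: k R) auto

lemma lift_prj: "lift k (prj i y) = prj i (if y < k then y else Suc y)"
  by (simp add: prj_def)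

text \<open>In the \<open>LLam\<close> case, \<open>lift_lift\<close> moves the inner
  \<open>lift 1\<close> past the outer lifting.\<close>

lemma tr_e_lift:
  "tr_e_cmd (lift_cmd k p) = lift k (tr_e_cmd p)"
  "tr_e_ltm (lift_ltm k t) = lift k (tr_e_ltm t)"
  "tr_e_rtm (lift_rtm k u) = lift k (tr_e_rtm u)"
  by (induction p and t and u arbitrary: k and k and k) (simp_all add: lift_prj lift_lift)

lemma reds_Pairing: "P \<rightarrow>\<^sub>S\<^sup>* P' \<Longrightarrow> Q \<rightarrow>\<^sub>S\<^sup>* Q' \<Longrightarrow> Pairing P Q \<rightarrow>\<^sub>S\<^sup>* Pairing P' Q'"
proof (induction rule: rtranclp_induct)
  case base
  then show ?case
    by (induction rule: rtranclp_induct) (auto intro: rtranclp.rtrancl_into_rtrancl red.pairR)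
qed (auto intro: rtranclp.rtrancl_into_rtrancl red.pairL)

lemma reds_Star: "P \<rightarrow>\<^sub>S\<^sup>* P' \<Longrightarrow> Q \<rightarrow>\<^sub>S\<^sup>* Q' \<Longrightarrow> P \<star> Q \<rightarrow>\<^sub>S\<^sup>* P' \<star> Q'"
proof (induction rule: rtranclp_induct)
  case base
  then show ?case
    by (induction rule: rtranclp_induct) (auto intro: rtranclp.rtrancl_into_rtrancl red.starR)
qed (auto intro: rtranclp.rtrancl_into_rtrancl red.starL)

lemma reds_Inj: "P \<rightarrow>\<^sub>S\<^sup>* P' \<Longrightarrow> Inj i P \<rightarrow>\<^sub>S\<^sup>* Inj i P'"
  by (induction rule: rtranclp_induct) (auto intro: rtranclp.rtrancl_into_rtrancl red.inj)

lemma reds_Lam: "P \<rightarrow>\<^sub>S\<^sup>* P' \<Longrightarrow> Lam P \<rightarrow>\<^sub>S\<^sup>* Lam P'"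
  by (induction rule: rtranclp_induct) (auto intro: rtranclp.rtrancl_into_rtrancl red.lam)

lemma Lam_Star_prj_reds: "Lam (lift 0 N \<star> prj i 0) \<rightarrow>\<^sub>S\<^sup>* Inj i N"
proof -
  have "lift 0 N \<star> prj i 0 \<rightarrow>\<^sub>S Var 0 \<star> lift 0 (Inj i N)"
    \<comment> \<open>\<open>Var 1 \<star> Inj i (Var 0)\<close> is the body of
      \<open>prj i 0\<close>.\<close>
    using red.beta_perp[of "lift 0 N" "Var 1 \<star> Inj i (Var 0)"] by (simp add: prj_def)
  then show ?thesis
    by (meson red.lam red.eta_perp converse_rtranclp_into_rtranclp rtranclp.rtrancl_refl)
qed

lemma Lam_prj_Star_reds: "Lam (prj i 0 \<star> lift 0 N) \<rightarrow>\<^sub>S\<^sup>* Inj i N"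
proof -
  have "prj i 0 \<star> lift 0 N \<rightarrow>\<^sub>S Var 0 \<star> lift 0 (Inj i N)"
    using red.beta[of "Var 1 \<star> Inj i (Var 0)" "lift 0 N"] by (simp add: prj_def)
  then show ?thesis
    by (meson red.lam red.eta_perp converse_rtranclp_into_rtranclp rtranclp.rtrancl_refl)
qed

lemma tr_e_tr_f_Inj_reds: "tr_e_ltm (tr_f_ltm (Inj i N)) \<rightarrow>\<^sub>S\<^sup>* Inj i (tr_e_ltm (tr_f_ltm N))"
proof (cases i)
  case I1
  define N' where "N' = tr_e_ltm (tr_f_ltm N)"
  have "prj I2 1 \<star> Lam (lift 0 (Var 0 \<star> lift 0 (lift 0 N'))) \<rightarrow>\<^sub>S Var 0 \<star> lift 0 (lift 0 N')"
    by (metis red.beta_perp subst_lift)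
  then have "Lam (prj I2 1 \<star> Lam (lift 0 (Var 0 \<star> lift 0 (lift 0 N')))) \<rightarrow>\<^sub>S\<^sup>* lift 0 N'"
    by (meson red.lam red.eta_perp converse_rtranclp_into_rtranclp rtranclp.rtrancl_refl)
  then have "Lam (Lam (prj I2 1 \<star> Lam (lift 0 (Var 0 \<star> lift 0 (lift 0 N')))) \<star> prj I1 0)
      \<rightarrow>\<^sub>S\<^sup>* Lam (lift 0 N' \<star> prj I1 0)"
    by (intro reds_Lam reds_Star) auto
  also note Lam_Star_prj_reds
  \<comment> \<open>This equation rewrites the left end of the chain.\<close>
  also have "Lam (Lam (prj I2 1 \<star> Lam (lift 0 (Var 0 \<star> lift 0 (lift 0 N')))) \<star> prj I1 0)
      = tr_e_ltm (tr_f_ltm (Inj i N))"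
    by (simp add: I1 N'_def tr_e_lift numeral_2_eq_2 flip: lift_lift)
  finally show ?thesis by (simp add: I1 N'_def)
next
  case I2
  define N' where "N' = tr_e_ltm (tr_f_ltm N)"
  have "Lam (prj I2 1 \<star> lift 0 (lift 0 N')) \<star> prj I1 0 \<rightarrow>\<^sub>S prj I2 0 \<star> lift 0 N'"
    \<comment> \<open>The binder is vacuous: with its body written as a lift,
      \<open>subst_lift\<close> erases \<open>prj I1 0\<close>.\<close>
    using red.beta[of "lift 0 (prj I2 0 \<star> lift 0 N')" "prj I1 0"]
    by (simp only: subst_lift) (simp add: lift_prj)
  then have "Lam (Lam (prj I2 1 \<star> lift 0 (lift 0 N')) \<star> prj I1 0) \<rightarrow>\<^sub>S\<^sup>* Inj I2 N'"
    by (meson red.lam Lam_prj_Star_reds converse_rtranclp_into_rtranclp)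
  then show ?thesis
    by (simp add: I2 N'_def tr_e_lift flip: lift_lift)
qed

text \<open>The type decides which of the two translations is defined on a subterm, hence the
  induction on typing.\<close>

lemma tr_e_tr_f_reds:
  "\<Gamma> \<turnstile> P : T \<Longrightarrow> (case T of Bot \<Rightarrow> tr_e_cmd (tr_f_cmd P) \<rightarrow>\<^sub>S\<^sup>* P
     | MT A \<Rightarrow> tr_e_ltm (tr_f_ltm P) \<rightarrow>\<^sub>S\<^sup>* P)"
proof (induction rule: typing.induct)
  case (ty_inj \<Gamma> P i A1 A2)
  then show ?case
    using rtranclp_trans[OF tr_e_tr_f_Inj_reds reds_Inj] by simp
qed (auto intro: reds_Pairing reds_Star reds_Lam)

theorem theorem4p14:
  fixes \<Gamma> :: "mtype list" and P :: trm and T :: ty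
  assumes "\<Gamma> \<turnstile> P : T"
  shows "tr_e (tr_f P) \<rightarrow>\<^sub>S\<^sup>* P"
  \<comment> \<open>\<open>scoped_f_aux\<close> matches \<open>T = Bot\<close> with the star case of
    \<open>tr_f\<close>.\<close>
  using tr_e_tr_f_reds[OF assms] scoped_f_aux[OF assms] by (cases T; cases P) auto

end
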